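(* Let $\mathcal{S}$ be a PNF-controllable set of subbands of basis $\mathcal{B}$ with binary function $\otimes$. Suppose $F_1$ and $F_2$ are polynomial neural fields of basis $\mathcal{B}$ that map $\mathbb{R}^n$ to $\mathbb{R}^m$, and suppose $F_1$ and $F_2$ are limited by the subbands $R_1\in\mathcal{S}$ and $R_2\in\mathcal{S}$ respectively. Then: 1. $W_1F_1(x)+W_2F_2(x)$ is a PNF of $\mathcal{B}$ limited by the subband $R_1\cup R_2$, for $W_1,W_2\in\mathbb{R}^{k\times m}$ (any output dimension $k\ge1$); 2. $F_1(x)^TWF_2(x)$ is a PNF of $\mathcal{B}$ limited by the subband $R_1\otimes R_2$, for $W\in\mathbb{R}^{m\times m}$.
   Context: $\mathcal{B}$ is a basis for the vector space of functions $\mathbb{R}^n\to\mathbb{R}$. A polynomial neural field (PNF) of basis $\mathcal{B}$ is a neural network $f=g_L\circ\dots\circ g_1\circ\gamma$, where every $g_i$ is a (vector-valued) multivariate polynomial of finite degree and $\gamma:\mathbb{R}^n\to\mathbb{R}^d$ is a feature encoding $\gamma(x)=[\gamma_1(x),\dots,\gamma_d(x)]^T$ with $\gamma_i\in\mathcal{B}$ for all $i$. A subband is a subset of $\mathcal{B}$. A PNF $F$ of basis $\mathcal{B}$ is limited by a subband $S\subset\mathcal{B}$ if $F$ (each coordinate of its output) is in the span of $S$. A set $\mathcal{S}=\{S_\theta\mid S_\theta\subset\mathcal{B}\}_\theta$ is a PNF-controllable set of subbands for $\mathcal{B}$ if (1) $S_{\theta_1}\cup S_{\theta_2}\in\mathcal{S}$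 for all $S_{\theta_1},S_{\theta_2}\in\mathcal{S}$, and (2) there exists a binary function $\otimes:\mathcal{S}\times\mathcal{S}\to\mathcal{S}$ such that $b_1\in S_{\theta_1}$, $b_2\in S_{\theta_2}$ implies $b_1b_2\in S_{\theta_1}\otimes S_{\theta_2}$. *)

theory Defs
  imports
    "HOL-Analysis.Finite_Cartesian_Product"
    "HOL-Library.Function_Algebras"
    "Jordan_Normal_Form.Matrix"
begin

text \<open>
  The domain is \<^typ>\<open>real ^ 'n\<close>, so that the scalar fields on it form a full function type, on
  which \<^const>\<open>span\<close> and \<^const>\<open>independent\<close> are available once it is a real vector space.
  Hidden layers have existentially quantified dimensions, so all encodings, layers and outputs
  are vectors of type \<^typ>\<open>real vec\<close>, with the dimension given by \<^const>\<open>carrier_vec\<close>.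
\<close>

unbundle no vec_syntax \<comment> \<open>from here on, the infix dollar sign is only \<^const>\<open>vec_index\<close>\<close>

instantiation "fun" :: (type, real_vector) real_vector
begin

definition scaleR_fun :: "real \<Rightarrow> ('a \<Rightarrow> 'b) \<Rightarrow> 'a \<Rightarrow> 'b" where
  "scaleR_fun c f = (\<lambda>x. c *\<^sub>R f x)"

instance
  by standard
    (simp_all add: scaleR_fun_def fun_eq_iff scaleR_add_right scaleR_add_left)

end

definition function_basis :: "('a \<Rightarrow> real) set \<Rightarrow> bool" where
  "function_basis B \<longleftrightarrow> independent B \<and> span B = UNIV"

definition polynomial_on :: "nat \<Rightarrow> (real vec \<Rightarrow> real) \<Rightarrow> bool" where
  "polynomial_on d p \<longleftrightarrow>
    (\<exists>(A :: (nat \<Rightarrow> nat) set) c. finite A \<and>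
      (\<forall>v\<in>carrier_vec d. p v = (\<Sum>\<alpha>\<in>A. c \<alpha> * (\<Prod>i<d. (v $ i) ^ \<alpha> i))))"

definition polynomial_map :: "nat \<Rightarrow> nat \<Rightarrow> (real vec \<Rightarrow> real vec) \<Rightarrow> bool" where
  "polynomial_map d e g \<longleftrightarrow>
    g \<in> carrier_vec d \<rightarrow> carrier_vec e \<and> (\<forall>j<e. polynomial_on d (\<lambda>v. g v $ j))"

definition feature_encoding ::
    "(real ^ 'n \<Rightarrow> real) set \<Rightarrow> nat \<Rightarrow> (real ^ 'n \<Rightarrow> real vec) \<Rightarrow> bool" where
  "feature_encoding B d \<gamma> \<longleftrightarrow>
    (\<forall>x. \<gamma> x \<in> carrier_vec d) \<and> (\<forall>i<d. (\<lambda>x. \<gamma> x $ i) \<in> B)"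

text \<open>
  A polynomial neural field with values in \<open>m\<close>-dimensional space. Layer \<open>g i\<close> maps dimension
  \<open>w (i - 1)\<close> to dimension \<open>w i\<close>, and \<^term>\<open>fold g [1..<Suc L] v\<close> is \<open>g L (\<dots> (g 1 v))\<close>.
\<close>

definition pnf :: "(real ^ 'n \<Rightarrow> real) set \<Rightarrow> nat \<Rightarrow> (real ^ 'n \<Rightarrow> real vec) \<Rightarrow> bool" where
  "pnf B m f \<longleftrightarrow>
    (\<exists>L w g \<gamma>. 1 \<le> L \<and> (\<forall>i\<le>L. 1 \<le> w i) \<and> w L = m \<and>
      feature_encoding B (w 0) \<gamma> \<and>
      (\<forall>i\<in>{1..L}. polynomial_map (w (i - 1)) (w i) (g i)) \<and>
      (\<forall>x. f x = fold g [1..<Suc L] (\<gamma> x)))"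

definition limited_by ::
    "(real ^ 'n \<Rightarrow> real) set \<Rightarrow> (real ^ 'n \<Rightarrow> real) set \<Rightarrow> nat \<Rightarrow> (real ^ 'n \<Rightarrow> real vec) \<Rightarrow> bool"
  where
  "limited_by B S m F \<longleftrightarrow> S \<subseteq> B \<and> (\<forall>i<m. (\<lambda>x. F x $ i) \<in> span S)"

definition subband_product ::
    "('a \<Rightarrow> real) set set \<Rightarrow> (('a \<Rightarrow> real) set \<Rightarrow> ('a \<Rightarrow> real) set \<Rightarrow> ('a \<Rightarrow> real) set) \<Rightarrow> bool"
  where
  "subband_product \<S> mul \<longleftrightarrow>
    (\<forall>S\<in>\<S>. \<forall>T\<in>\<S>. mul S T \<in> \<S> \<and> (\<forall>b\<in>S. \<forall>c\<in>T. (\<lambda>x. b x * c x) \<in> mul S T))"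

definition pnf_controllable :: "('a \<Rightarrow> real) set \<Rightarrow> ('a \<Rightarrow> real) set set \<Rightarrow> bool" where
  "pnf_controllable B \<S> \<longleftrightarrow>
    (\<forall>S\<in>\<S>. S \<subseteq> B) \<and> (\<forall>S\<in>\<S>. \<forall>T\<in>\<S>. S \<union> T \<in> \<S>) \<and> (\<exists>mul. subband_product \<S> mul)"

end

theory Submission
  imports Defs
begin

text \<open>
  Polynomials are closed under composition, so a polynomial neural field is the same thing as a
  single polynomial layer applied to a feature encoding. Concatenating the encodings of two fields
  lets one polynomial layer compute any polynomial expression in both of them.
  The bandwidth claims are the (bi)linearity of the two operations.
\<close>

section \<open>Closure properties of scalar polynomials\<close>

lemma polynomial_on_cong:
  assumes "polynomial_on d p" and "\<And>v. v \<in> carrier_vec d \<Longrightarrow> q v = p v"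
  shows "polynomial_on d q"
  using assms by (simp add: polynomial_on_def)

lemma polynomial_on_monomial:
  "polynomial_on d (\<lambda>v. a * (\<Prod>i<d. (v $ i) ^ \<alpha> i))"
  unfolding polynomial_on_def
  by (rule exI[of _ "{\<alpha>}"], rule exI[of _ "\<lambda>_. a"]) simp

lemma polynomial_on_const: "polynomial_on d (\<lambda>_. a)"
  by (rule polynomial_on_cong[OF polynomial_on_monomial[of d a "\<lambda>_. 0"]]) simp

lemma polynomial_on_coordinate:
  assumes "i < d"
  shows "polynomial_on d (\<lambda>v. v $ i)"
\<comment> \<open>The exponents form the unit multi-index at \<open>i\<close>, so every factor with
  \<open>j \<noteq> i\<close> is a zeroth power.\<close>
proof (rule polynomial_on_cong[OF polynomial_on_monomial[of d 1 "\<lambda>j. if j = i then 1 else 0"]])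
  fix v :: "real vec"
  have "(\<Prod>j<d. (v $ j) ^ (if j = i then 1 else 0)) = (\<Prod>j<d. if j = i then v $ j else 1)"
    by (rule prod.cong) auto
  then show "v $ i = 1 * (\<Prod>j<d. (v $ j) ^ (if j = i then 1 else 0))"
    using assms by (simp add: prod.delta)
qed

lemma polynomial_on_add:
  assumes "polynomial_on d p" and "polynomial_on d q"
  shows "polynomial_on d (\<lambda>v. p v + q v)"
proof -
  let ?mon = "\<lambda>v \<alpha>. \<Prod>i<d. (v $ i) ^ \<alpha> i"
  obtain A a where A: "finite A"
      and p: "\<And>v. v \<in> carrier_vec d \<Longrightarrow> p v = (\<Sum>\<alpha>\<in>A. a \<alpha> * ?mon v \<alpha>)"
    using assms(1) unfolding polynomial_on_def by blast
  obtain C c where C: "finite C"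
      and q: "\<And>v. v \<in> carrier_vec d \<Longrightarrow> q v = (\<Sum>\<alpha>\<in>C. c \<alpha> * ?mon v \<alpha>)"
    using assms(2) unfolding polynomial_on_def by blast
  \<comment> \<open>Both coefficient families are extended by 0 to the common index set
    \<open>A \<union> C\<close>, so that the two sums merge term by term.\<close>
  have extend: "(\<Sum>\<alpha>\<in>A \<union> C. (if \<alpha> \<in> D then e \<alpha> else 0) * ?mon v \<alpha>) = (\<Sum>\<alpha>\<in>D. e \<alpha> * ?mon v \<alpha>)"
    if "D \<subseteq> A \<union> C" for D e and v :: "real vec"
    by (rule sum.mono_neutral_cong_right) (use A C that in auto)
  have "p v + q v = (\<Sum>\<alpha>\<in>A \<union> C.
      ((if \<alpha> \<in> A then a \<alpha> else 0) + (if \<alpha> \<in> C then c \<alpha> else 0)) * ?mon v \<alpha>)"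
    if "v \<in> carrier_vec d" for v
    unfolding distrib_right sum.distrib using that by (simp add: extend p q)
  then show ?thesis
    unfolding polynomial_on_def using A C
    by (intro exI[of _ "A \<union> C"] exI conjI ballI) auto
qed

lemma polynomial_on_sum:
  assumes "\<And>i. i \<in> I \<Longrightarrow> polynomial_on d (p i)"
  shows "polynomial_on d (\<lambda>v. \<Sum>i\<in>I. p i v)"
  using assms
  \<comment> \<open>For infinite \<open>I\<close> the sum is 0 by convention, hence a constant
    polynomial.\<close>
  by (induction I rule: infinite_finite_induct)
     (simp_all add: polynomial_on_const polynomial_on_add)

lemma polynomial_on_mult:
  assumes "polynomial_on d p" and "polynomial_on d q"
  shows "polynomial_on d (\<lambda>v. p v * q v)"
proof -
  let ?mon = "\<lambda>v \<alpha>. \<Prod>i<d. (v $ i) ^ \<alpha> i"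
  obtain A a where A: "finite A"
      and p: "\<And>v. v \<in> carrier_vec d \<Longrightarrow> p v = (\<Sum>\<alpha>\<in>A. a \<alpha> * ?mon v \<alpha>)"
    using assms(1) unfolding polynomial_on_def by blast
  obtain C c where C: "finite C"
      and q: "\<And>v. v \<in> carrier_vec d \<Longrightarrow> q v = (\<Sum>\<alpha>\<in>C. c \<alpha> * ?mon v \<alpha>)"
    using assms(2) unfolding polynomial_on_def by blast
  \<comment> \<open>Multiplying out adds the exponents. Different pairs can give the same exponent;
    closure under sums absorbs these collisions.\<close>
  have "polynomial_on d
      (\<lambda>v. \<Sum>\<alpha>\<in>A. \<Sum>\<beta>\<in>C. (a \<alpha> * c \<beta>) * ?mon v (\<lambda>i. \<alpha> i + \<beta> i))"
    by (intro polynomial_on_sum polynomial_on_monomial)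
  then show ?thesis
    by (rule polynomial_on_cong)
       (simp add: p q sum_product power_add prod.distrib mult_ac)
qed

lemma polynomial_on_prod:
  assumes "\<And>i. i \<in> I \<Longrightarrow> polynomial_on d (p i)"
  shows "polynomial_on d (\<lambda>v. \<Prod>i\<in>I. p i v)"
  using assms
  by (induction I rule: infinite_finite_induct)
     (simp_all add: polynomial_on_const polynomial_on_mult)

lemma polynomial_on_power:
  assumes "polynomial_on d p"
  shows "polynomial_on d (\<lambda>v. p v ^ n)"
  by (induction n) (simp_all add: polynomial_on_const polynomial_on_mult assms)

text \<open>Substituting the coordinates of \<open>g\<close> into each monomial leaves sums,
  products and powers of polynomials. The expansion of \<open>p\<close> is valid at
  \<open>g v\<close> because \<open>g\<close> maps into \<open>carrier_vec e\<close>.\<close>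

lemma polynomial_on_compose:
  assumes "polynomial_on e p" and g: "polynomial_map d e g"
  shows "polynomial_on d (\<lambda>v. p (g v))"
proof -
  obtain A c where
    p: "\<And>v. v \<in> carrier_vec e \<Longrightarrow> p v = (\<Sum>\<alpha>\<in>A. c \<alpha> * (\<Prod>i<e. (v $ i) ^ \<alpha> i))"
    using assms(1) unfolding polynomial_on_def by blast
  have "polynomial_on d (\<lambda>v. \<Sum>\<alpha>\<in>A. c \<alpha> * (\<Prod>i<e. (g v $ i) ^ \<alpha> i))"
    using g unfolding polynomial_map_def
    by (intro polynomial_on_sum polynomial_on_mult polynomial_on_const polynomial_on_prod
        polynomial_on_power) auto
  then show ?thesis
    by (rule polynomial_on_cong) (use g in \<open>auto simp: polynomial_map_def intro!: p\<close>)
qed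

section \<open>Polynomial maps: composition, concatenation and projections\<close>

lemma polynomial_map_compose:
  assumes "polynomial_map d e g" and "polynomial_map e k h"
  shows "polynomial_map d k (\<lambda>v. h (g v))"
  unfolding polynomial_map_def
proof (intro conjI allI impI)
  show "(\<lambda>v. h (g v)) \<in> carrier_vec d \<rightarrow> carrier_vec k"
    using assms by (auto simp: polynomial_map_def)
next
  fix j assume "j < k"
  then show "polynomial_on d (\<lambda>v. h (g v) $ j)"
    using assms(2) by (intro polynomial_on_compose[OF _ assms(1)]) (simp add: polynomial_map_def)
qed

lemma polynomial_map_vec:
  assumes "\<And>j. j < e \<Longrightarrow> polynomial_on d (p j)"
  shows "polynomial_map d e (\<lambda>v. vec e (\<lambda>j. p j v))"
  using assms by (simp add: polynomial_map_def)

lemma polynomial_map_append: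
  assumes g: "polynomial_map d e g" and h: "polynomial_map d k h"
  shows "polynomial_map d (e + k) (\<lambda>v. g v @\<^sub>v h v)"
proof -
  have car: "g v \<in> carrier_vec e" "h v \<in> carrier_vec k" if "v \<in> carrier_vec d" for v
    using g h that by (auto simp: polynomial_map_def)
  have "polynomial_on d (\<lambda>v. (g v @\<^sub>v h v) $ j)" if "j < e + k" for j
  proof (rule polynomial_on_cong)
    \<comment> \<open>The case distinction depends on \<open>j\<close> alone and stands outside the
      function, so each branch is a single coordinate of \<open>g\<close> or
      \<open>h\<close>.\<close>
    show "polynomial_on d (if j < e then (\<lambda>v. g v $ j) else (\<lambda>v. h v $ (j - e)))"
      using g h that by (simp add: polynomial_map_def)
  next
    fix v :: "real vec" assume "v \<in> carrier_vec d"
    then show "(g v @\<^sub>v h v) $ j = (if j < e then (\<lambda>v. g v $ j) else (\<lambda>v. h v $ (j - e))) v"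
      using car[of v] that by auto
  qed
  then show ?thesis
    using car by (auto simp: polynomial_map_def)
qed

lemma polynomial_map_vec_first: "polynomial_map (d + e) d (\<lambda>v. vec_first v d)"
  unfolding vec_first_def by (intro polynomial_map_vec polynomial_on_coordinate) simp

lemma vec_first_append:
  assumes "u \<in> carrier_vec d"
  shows "vec_first (u @\<^sub>v v) d = u"
  using assms by (intro eq_vecI) (auto simp: vec_first_def)

lemma vec_last_append:
  assumes "u \<in> carrier_vec d" and "v \<in> carrier_vec e"
  shows "vec_last (u @\<^sub>v v) e = v"
  using assms by (intro eq_vecI) (auto simp: vec_last_def)

lemma polynomial_map_vec_last: "polynomial_map (d + e) e (\<lambda>v. vec_last v e)"
proof -
  \<comment> \<open>\<open>vec_last\<close> counts back from the actual length of its argument, so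
    its entry \<open>j\<close> is entry \<open>d + j\<close> only on vectors of dimension
    \<open>d + e\<close>.\<close>
  have "polynomial_on (d + e) (\<lambda>v. vec_last v e $ j)" if "j < e" for j
    by (rule polynomial_on_cong[OF polynomial_on_coordinate[of "d + j"]])
       (use that in \<open>auto simp: vec_last_def\<close>)
  then show ?thesis
    by (simp add: polynomial_map_def)
qed

section \<open>Collapsing a network to one polynomial layer\<close>

lemma polynomial_map_fold:
  assumes "\<And>i. i \<in> {1..L} \<Longrightarrow> polynomial_map (w (i - 1)) (w i) (g i)"
  shows "polynomial_map (w 0) (w L) (fold g [1..<Suc L])"
  using assms
proof (induction L)
  case 0
  \<comment> \<open>Without layers the list is empty and \<open>fold\<close> is the
    identity.\<close>
  show ?case
    by (auto simp: polynomial_map_def polynomial_on_coordinate)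
next
  case (Suc L)
  have "polynomial_map (w 0) (w L) (fold g [1..<Suc L])"
    using Suc by simp
  moreover have "polynomial_map (w L) (w (Suc L)) (g (Suc L))"
    using Suc.prems[of "Suc L"] by simp
  \<comment> \<open>The new index is appended at the end of the list, so \<open>g (Suc L)\<close> is
    the outermost layer.\<close>
  ultimately show ?case
    using polynomial_map_compose by (fastforce simp: comp_def)
qed

text \<open>Depth and hidden widths disappear from the description, so two fields of different
  depths can be combined without aligning their layers. The bounds on \<open>d\<close> and
  \<open>m\<close> are what remains of the positivity of all widths.\<close>

lemma pnf_iff_single_layer:
  "pnf B m F \<longleftrightarrow> (\<exists>d G \<gamma>. 1 \<le> d \<and> 1 \<le> m \<and> feature_encoding B d \<gamma> \<and>
    polynomial_map d m G \<and> (\<forall>x. F x = G (\<gamma> x)))"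
proof
  assume "pnf B m F"
  then obtain L w g \<gamma> where
      w: "\<forall>i\<le>L. 1 \<le> w i" "w L = m"
    and \<gamma>: "feature_encoding B (w 0) \<gamma>"
    and g: "\<forall>i\<in>{1..L}. polynomial_map (w (i - 1)) (w i) (g i)"
    and F: "\<forall>x. F x = fold g [1..<Suc L] (\<gamma> x)"
    unfolding pnf_def by blast
  have "polynomial_map (w 0) m (fold g [1..<Suc L])"
    using polynomial_map_fold[of L w g] g w(2) by blast
  then show "\<exists>d G \<gamma>. 1 \<le> d \<and> 1 \<le> m \<and> feature_encoding B d \<gamma> \<and>
      polynomial_map d m G \<and> (\<forall>x. F x = G (\<gamma> x))"
    using w \<gamma> F by blast
next
  assume "\<exists>d G \<gamma>. 1 \<le> d \<and> 1 \<le> m \<and> feature_encoding B d \<gamma> \<and>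
    polynomial_map d m G \<and> (\<forall>x. F x = G (\<gamma> x))"
  then obtain d G \<gamma> where "1 \<le> d" "1 \<le> m" "feature_encoding B d \<gamma>"
      "polynomial_map d m G" "\<forall>x. F x = G (\<gamma> x)"
    by blast
  then show "pnf B m F"
    unfolding pnf_def
    \<comment> \<open>A network of depth 1: width \<open>d\<close> at the encoding and
      \<open>m\<close> at the output.\<close>
    by (intro exI[of _ 1] exI[of _ "\<lambda>i. if i = 0 then d else m"] exI[of _ "\<lambda>_. G"] exI[of _ \<gamma>])
       auto
qed

lemma pnf_carrier:
  assumes "pnf B m F"
  shows "F x \<in> carrier_vec m"
  using assms by (auto simp: pnf_iff_single_layer feature_encoding_def polynomial_map_def)

lemma feature_encoding_append:
  assumes "feature_encoding B d \<gamma>" and "feature_encoding B e \<delta>"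
  shows "feature_encoding B (d + e) (\<lambda>x. \<gamma> x @\<^sub>v \<delta> x)"
proof -
  have car: "\<gamma> x \<in> carrier_vec d" "\<delta> x \<in> carrier_vec e" for x
    using assms by (auto simp: feature_encoding_def)
  have "(\<lambda>x. (\<gamma> x @\<^sub>v \<delta> x) $ i) = (if i < d then (\<lambda>x. \<gamma> x $ i) else (\<lambda>x. \<delta> x $ (i - d)))"
    if "i < d + e" for i
    using that car[THEN carrier_vecD] by (auto simp: fun_eq_iff)
  then show ?thesis
    using assms by (auto simp: feature_encoding_def)
qed

text \<open>Leaving \<open>H\<close> arbitrary serves both claims: a sum of linear images and a
  bilinear form are each a polynomial map of the concatenated outputs.\<close>

lemma pnf_polynomial_combination:
  assumes "pnf B m1 F1" and "pnf B m2 F2"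
    and H: "polynomial_map (m1 + m2) k H" and "1 \<le> k"
  shows "pnf B k (\<lambda>x. H (F1 x @\<^sub>v F2 x))"
proof -
  obtain d1 G1 \<gamma>1 where 1: "1 \<le> d1" "feature_encoding B d1 \<gamma>1" "polynomial_map d1 m1 G1"
      "\<And>x. F1 x = G1 (\<gamma>1 x)"
    using assms(1) unfolding pnf_iff_single_layer by blast
  obtain d2 G2 \<gamma>2 where 2: "1 \<le> d2" "feature_encoding B d2 \<gamma>2" "polynomial_map d2 m2 G2"
      "\<And>x. F2 x = G2 (\<gamma>2 x)"
    using assms(2) unfolding pnf_iff_single_layer by blast
  have car: "\<gamma>1 x \<in> carrier_vec d1" "\<gamma>2 x \<in> carrier_vec d2" for x
    using 1 2 by (auto simp: feature_encoding_def)
  \<comment> \<open>The joint layer splits the concatenated features, runs each collapsed network on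
    its own half, and applies \<open>H\<close> to the results.\<close>
  define G where "G v = H (G1 (vec_first v d1) @\<^sub>v G2 (vec_last v d2))" for v
  have "polynomial_map (d1 + d2) k G"
    unfolding G_def
    by (intro polynomial_map_compose[OF _ H] polynomial_map_append
        polynomial_map_compose[OF polynomial_map_vec_first 1(3)]
        polynomial_map_compose[OF polynomial_map_vec_last 2(3)])
  moreover have "H (F1 x @\<^sub>v F2 x) = G (\<gamma>1 x @\<^sub>v \<gamma>2 x)" for x
    using car[of x] by (simp add: G_def 1(4) 2(4) vec_first_append vec_last_append)
  ultimately show ?thesis
    unfolding pnf_iff_single_layer
    using \<open>1 \<le> k\<close> 1(1) feature_encoding_append[OF 1(2) 2(2)]
    by (intro exI[of _ "d1 + d2"] exI[of _ G] exI[of _ "\<lambda>x. \<gamma>1 x @\<^sub>v \<gamma>2 x"]) auto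
qed

section \<open>Matrix action, vector addition and scalar product as polynomials\<close>

lemma polynomial_map_mult_mat_vec:
  assumes "W \<in> carrier_mat k m"
  shows "polynomial_map m k (\<lambda>v. W *\<^sub>v v)"
proof -
  have "polynomial_on m (\<lambda>v. (W *\<^sub>v v) $ i)" if "i < k" for i
  proof (rule polynomial_on_cong)
    show "polynomial_on m (\<lambda>v. \<Sum>j = 0..<m. W $$ (i, j) * v $ j)"
      by (intro polynomial_on_sum polynomial_on_mult polynomial_on_const polynomial_on_coordinate)
         simp
  qed (use assms that in \<open>auto simp: scalar_prod_def\<close>)
  then show ?thesis
    using assms by (auto simp: polynomial_map_def)
qed

lemma polynomial_map_add:
  assumes g: "polynomial_map d k g" and h: "polynomial_map d k h"
  shows "polynomial_map d k (\<lambda>v. g v + h v)"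
proof -
  have car: "g v \<in> carrier_vec k" "h v \<in> carrier_vec k" if "v \<in> carrier_vec d" for v
    using g h that by (auto simp: polynomial_map_def)
  have "polynomial_on d (\<lambda>v. (g v + h v) $ i)" if "i < k" for i
  proof (rule polynomial_on_cong)
    show "polynomial_on d (\<lambda>v. g v $ i + h v $ i)"
      using g h that by (intro polynomial_on_add) (auto simp: polynomial_map_def)
  next
    fix v :: "real vec" assume "v \<in> carrier_vec d"
    then show "(g v + h v) $ i = g v $ i + h v $ i"
      using car[of v] that by simp
  qed
  then show ?thesis
    using car by (auto simp: polynomial_map_def)
qed

lemma polynomial_on_scalar_prod:
  assumes g: "polynomial_map d k g" and h: "polynomial_map d k h"
  shows "polynomial_on d (\<lambda>v. g v \<bullet> h v)"
proof (rule polynomial_on_cong)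
  show "polynomial_on d (\<lambda>v. \<Sum>i = 0..<k. g v $ i * h v $ i)"
    using g h by (intro polynomial_on_sum polynomial_on_mult) (auto simp: polynomial_map_def)
next
  fix v :: "real vec" assume "v \<in> carrier_vec d"
  then have "h v \<in> carrier_vec k"
    using h by (auto simp: polynomial_map_def)
  then show "g v \<bullet> h v = (\<Sum>i = 0..<k. g v $ i * h v $ i)"
    by (simp add: scalar_prod_def)
qed

section \<open>Spans of real-valued functions under pointwise operations\<close>

lemma span_fun_add:
  fixes f g :: "'a \<Rightarrow> real"
  assumes "f \<in> span S" and "g \<in> span S"
  shows "(\<lambda>x. f x + g x) \<in> span S"
  using span_add[OF assms] by (simp add: plus_fun_def)

lemma span_fun_cmult:
  fixes f :: "'a \<Rightarrow> real"
  assumes "f \<in> span S"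
  shows "(\<lambda>x. a * f x) \<in> span S"
  using span_scale[OF assms, of a] by (simp add: scaleR_fun_def)

lemma span_fun_sum:
  fixes f :: "'i \<Rightarrow> 'a \<Rightarrow> real"
  assumes "\<And>i. i \<in> I \<Longrightarrow> f i \<in> span S"
  shows "(\<lambda>x. \<Sum>i\<in>I. f i x) \<in> span S"
  using assms
proof (induction I rule: infinite_finite_induct)
  case (insert i I)
  then show ?case
    by (simp add: span_fun_add)
qed (use span_zero[of S] in \<open>simp_all add: zero_fun_def\<close>)

text \<open>Multiplication is bilinear: with one factor fixed, the functions whose product with it
  lies in \<open>span U\<close> form a subspace. Span induction in each factor in turn reduces the
  claim to products of generators.\<close>

lemma span_fun_mult:
  fixes f g :: "'a \<Rightarrow> real"
  assumes f: "f \<in> span S" and g: "g \<in> span T"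
    and prod: "\<And>b c. b \<in> S \<Longrightarrow> c \<in> T \<Longrightarrow> (\<lambda>x. b x * c x) \<in> span U"
  shows "(\<lambda>x. f x * g x) \<in> span U"
proof -
  have zero: "(\<lambda>_. 0) \<in> span U"
    using span_zero[of U] by (simp add: zero_fun_def)
  have sub: "subspace {f. (\<lambda>x. f x * h x) \<in> span U}" for h :: "'a \<Rightarrow> real"
    using zero
    by (auto simp: subspace_def scaleR_fun_def plus_fun_def distrib_right mult.assoc
        intro: span_fun_add span_fun_cmult)
  \<comment> \<open>The first induction lets \<open>g\<close> range over \<open>span T\<close>
    against a fixed generator \<open>b\<close>; the second, below, lets \<open>f\<close> range over
    \<open>span S\<close> against the fixed \<open>g\<close>.\<close>
  have "(\<lambda>x. g x * b x) \<in> span U" if "b \<in> S" for b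
    using span_induct[OF g sub[of b]] prod[OF that] by (simp add: mult.commute)
  then show ?thesis
    using span_induct[OF f sub[of g]] by (simp add: mult.commute)
qed

section \<open>Bandwidth of linear images, sums and scalar products\<close>

lemma limited_by_mult_mat_vec:
  assumes "limited_by B S m F" and "\<And>x. F x \<in> carrier_vec m" and "W \<in> carrier_mat k m"
  shows "limited_by B S k (\<lambda>x. W *\<^sub>v F x)"
proof -
  \<comment> \<open>\<open>scalar_prod\<close> sums over the dimension of its second argument, which
    the carrier assumption fixes to \<open>m\<close>.\<close>
  have "(\<lambda>x. (W *\<^sub>v F x) $ i) = (\<lambda>x. \<Sum>j = 0..<m. W $$ (i, j) * F x $ j)" if "i < k" for i
    using assms(2)[THEN carrier_vecD] assms(3) that by (auto simp: scalar_prod_def)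
  then show ?thesis
    using assms(1) by (auto simp: limited_by_def intro!: span_fun_sum span_fun_cmult)
qed

text \<open>Both spans embed in the span of the union. Vector addition takes its dimension from the
  second summand, which is why the carrier assumption concerns \<open>G\<close>.\<close>

lemma limited_by_add:
  assumes "limited_by B S k F" and "limited_by B T k G"
    and "\<And>x. G x \<in> carrier_vec k"
  shows "limited_by B (S \<union> T) k (\<lambda>x. F x + G x)"
proof -
  have "(\<lambda>x. (F x + G x) $ i) = (\<lambda>x. F x $ i + G x $ i)" if "i < k" for i
    using assms(3)[THEN carrier_vecD] that by simp
  moreover have "span S \<subseteq> span (S \<union> T)" "span T \<subseteq> span (S \<union> T)"
    by (simp_all add: span_mono)
  ultimately show ?thesis
    using assms(1,2) by (auto simp: limited_by_def intro!: span_fun_add)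
qed

text \<open>The scalar product is a sum of products of coordinates, each controlled by
  \<open>span_fun_mult\<close>. The scalar is wrapped by \<open>vec 1\<close> because fields are
  vector-valued.\<close>

lemma limited_by_scalar_prod:
  assumes "limited_by B S m F" and "limited_by B T m G" and "\<And>x. G x \<in> carrier_vec m"
    and "U \<subseteq> B" and "\<And>b c. b \<in> S \<Longrightarrow> c \<in> T \<Longrightarrow> (\<lambda>x. b x * c x) \<in> U"
  shows "limited_by B U 1 (\<lambda>x. vec 1 (\<lambda>_. F x \<bullet> G x))"
proof -
  have "(\<lambda>x. F x \<bullet> G x) = (\<lambda>x. \<Sum>i = 0..<m. F x $ i * G x $ i)"
    using assms(3)[THEN carrier_vecD] by (simp add: scalar_prod_def)
  moreover have "(\<lambda>x. F x $ i * G x $ i) \<in> span U" if "i < m" for i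
    by (rule span_fun_mult[of _ S _ T])
       (use assms(1,2) that in \<open>simp_all add: limited_by_def span_base assms(5)\<close>)
  ultimately show ?thesis
    using assms(4) by (auto simp: limited_by_def intro!: span_fun_sum)
qed

section \<open>Linear combinations and bilinear forms of two fields\<close>

theorem theorem2:
  fixes B :: "(real ^ 'n \<Rightarrow> real) set"
    and \<S> :: "(real ^ 'n \<Rightarrow> real) set set"
    and R1 R2 :: "(real ^ 'n \<Rightarrow> real) set"
    and mul :: "(real ^ 'n \<Rightarrow> real) set \<Rightarrow> (real ^ 'n \<Rightarrow> real) set \<Rightarrow> (real ^ 'n \<Rightarrow> real) set"
    and F1 F2 :: "real ^ 'n \<Rightarrow> real vec"
    and m :: nat
  assumes "function_basis B"
    and "pnf_controllable B \<S>" and "subband_product \<S> mul"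
    and "pnf B m F1" and "pnf B m F2"
    and "R1 \<in> \<S>" and "R2 \<in> \<S>"
    and "limited_by B R1 m F1" and "limited_by B R2 m F2"
  shows "(\<forall>k\<ge>1. \<forall>W1\<in>carrier_mat k m. \<forall>W2\<in>carrier_mat k m.
            pnf B k (\<lambda>x. W1 *\<^sub>v F1 x + W2 *\<^sub>v F2 x) \<and>
            limited_by B (R1 \<union> R2) k (\<lambda>x. W1 *\<^sub>v F1 x + W2 *\<^sub>v F2 x)) \<and>
         (\<forall>W\<in>carrier_mat m m.
            pnf B 1 (\<lambda>x. vec 1 (\<lambda>_. F1 x \<bullet> (W *\<^sub>v F2 x))) \<and>
            limited_by B (mul R1 R2) 1 (\<lambda>x. vec 1 (\<lambda>_. F1 x \<bullet> (W *\<^sub>v F2 x))))"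
proof (intro conjI allI impI ballI)
  note car = pnf_carrier[OF assms(4)] pnf_carrier[OF assms(5)]
  \<comment> \<open>The projections recover the two fields from their concatenation; this turns the
    generic \<open>H\<close> below into the expressions of the claim.\<close>
  have decomp: "vec_first (F1 x @\<^sub>v F2 x) m = F1 x" "vec_last (F1 x @\<^sub>v F2 x) m = F2 x" for x
    using car[of x] by (simp_all add: vec_first_append vec_last_append)
  note combine = pnf_polynomial_combination[OF assms(4,5)]
  {
    fix k and W1 W2 :: "real mat"
    assume k: "1 \<le> k" and W: "W1 \<in> carrier_mat k m" "W2 \<in> carrier_mat k m"
    show "pnf B k (\<lambda>x. W1 *\<^sub>v F1 x + W2 *\<^sub>v F2 x)"
      \<comment> \<open>Here \<open>H v\<close> is
        \<open>W1 *\<^sub>v vec_first v m + W2 *\<^sub>v vec_last v m\<close>.\<close>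
      using combine[OF polynomial_map_add[OF
            polynomial_map_compose[OF polynomial_map_vec_first polynomial_map_mult_mat_vec[OF W(1)]]
            polynomial_map_compose[OF polynomial_map_vec_last polynomial_map_mult_mat_vec[OF W(2)]]]
          k]
      by (simp add: decomp)
    show "limited_by B (R1 \<union> R2) k (\<lambda>x. W1 *\<^sub>v F1 x + W2 *\<^sub>v F2 x)"
      by (rule limited_by_add)
         (use limited_by_mult_mat_vec[OF assms(8) car(1) W(1)]
            limited_by_mult_mat_vec[OF assms(9) car(2) W(2)] W car in auto)
  }
  fix W :: "real mat"
  assume W: "W \<in> carrier_mat m m"
  show "pnf B 1 (\<lambda>x. vec 1 (\<lambda>_. F1 x \<bullet> (W *\<^sub>v F2 x)))"
    \<comment> \<open>Here \<open>H v\<close> is the one-entry vector holding the scalar product of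
      \<open>vec_first v m\<close> with \<open>W *\<^sub>v vec_last v m\<close>.\<close>
    using combine[OF polynomial_map_vec[OF polynomial_on_scalar_prod[OF
            polynomial_map_vec_first
            polynomial_map_compose[OF polynomial_map_vec_last polynomial_map_mult_mat_vec[OF W]]]],
        of 1]
    by (simp add: decomp)
  \<comment> \<open>Membership in \<open>\<S>\<close> matters because controllability places every
    member of \<open>\<S>\<close> inside \<open>B\<close>, as \<open>limited_by\<close>
    demands.\<close>
  have "mul R1 R2 \<in> \<S>" and "\<And>b c. b \<in> R1 \<Longrightarrow> c \<in> R2 \<Longrightarrow> (\<lambda>x. b x * c x) \<in> mul R1 R2"
    using assms(3,6,7) by (auto simp: subband_product_def)
  moreover from this(1) have "mul R1 R2 \<subseteq> B"
    using assms(2) by (auto simp: pnf_controllable_def)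
  ultimately show "limited_by B (mul R1 R2) 1 (\<lambda>x. vec 1 (\<lambda>_. F1 x \<bullet> (W *\<^sub>v F2 x)))"
    using W car
    by (intro limited_by_scalar_prod[OF assms(8) limited_by_mult_mat_vec[OF assms(9) car(2) W]])
       auto
qed

end
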